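(* Let $(X,d)$ be a metric space equipped with a closed partial order $\le$ for which the space is monotone normal. Then for $\mu,\nu\in\mathcal{P}(X)$ the following are equivalent: (1) $\mu\le\nu$ in the stochastic order; (2) for every continuous monotone $f:X\to[0,\infty)$, $\int_X f\,d\mu\le\int_X f\,d\nu$; (2$'$) for every continuous bounded monotone $f:X\to[0,\infty)$, $\int_X f\,d\mu\le\int_X f\,d\nu$. (Integrals are allowed to be $+\infty$.)
   Context: A partial order $\le$ on a metric space $X$ is closed if $\{(x,y):x\le y\}$ is closed in $X\times X$. A subset $A\subseteq X$ is an upper set if $x\in A$ and $x\le y$ imply $y\in A$; it is a lower set if $x\in A$ and $y\le x$ imply $y\in A$. A real function $f$ on $X$ is monotone if $x\le y$ implies $f(x)\le f(y)$. A topological space equipped with a closed order is monotone normal if, given a closed upper set $A$ and a closed lower set $B$ with $A\cap B=\emptyset$, there exist an open upper set $U\supseteq A$ and an open lower set $V\supseteq B$ with $U\cap V=\emptyset$. $\mathcal{P}(X)$ denotes the set of Borel probability measures $\mu$ on $X$ satisfying all four of the following conditions: the support of $\mu$ has measure $1$; $\mu$ is $\tau$-additive, i.e. $\mu(U)=\sup_\alpha\mu(U_\alpha)$ for every directed union $U=\bigcup_\alpha U_\alpha$ of open sets; $\mu$ is the weak limit of a sequence of finitely supported measures; $\mu$ is inner regular, i.e. for every Borel set $A$ and $\varepsilon>0$ there is a compact $K\subseteq A$ with $\mu(A)-\varepsilon<\mu(K)$. (The first three are always equivalent, and all four are equivalent when $X$ is complete.) The stochastic order on $\mathcal{P}(X)$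 is defined by: $\mu\le\nu$ if $\mu(U)\le\nu(U)$ for each open upper set $U\subseteq X$. *)

theory Defs
  imports "HOL-Probability.Probability"
begin

text \<open>
  The ordered metric space \<open>(X, d, \<le>)\<close> is rendered as a type of sort
  \<open>{metric_space, order}\<close>. These two classes are unrelated: the order is an arbitrary
  partial order, independent of the metric.
\<close>

definition closed_order :: "'a::{topological_space, order} itself \<Rightarrow> bool" where
  "closed_order _ \<longleftrightarrow> closed {(x :: 'a, y). x \<le> y}"

definition upper_set :: "'a::order set \<Rightarrow> bool" where
  "upper_set A \<longleftrightarrow> (\<forall>x y. x \<in> A \<longrightarrow> x \<le> y \<longrightarrow> y \<in> A)"

definition lower_set :: "'a::order set \<Rightarrow> bool" where
  "lower_set A \<longleftrightarrow> (\<forall>x y. x \<in> A \<longrightarrow> y \<le> x \<longrightarrow> y \<in> A)"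

definition monotone_normal :: "'a::{topological_space, order} itself \<Rightarrow> bool" where
  "monotone_normal _ \<longleftrightarrow>
    (\<forall>A B :: 'a set.
       closed A \<and> upper_set A \<and> closed B \<and> lower_set B \<and> A \<inter> B = {} \<longrightarrow>
       (\<exists>U V. open U \<and> upper_set U \<and> A \<subseteq> U \<and>
              open V \<and> lower_set V \<and> B \<subseteq> V \<and> U \<inter> V = {}))"

definition msupport :: "'a::topological_space measure \<Rightarrow> 'a set" where
  "msupport M = {x. \<forall>U. open U \<longrightarrow> x \<in> U \<longrightarrow> emeasure M U > 0}"

definition tau_additive :: "'a::topological_space measure \<Rightarrow> bool" where
  "tau_additive M \<longleftrightarrow>
    (\<forall>\<U>. \<U> \<noteq> {} \<and> (\<forall>U\<in>\<U>. open U) \<and> (\<forall>U\<in>\<U>. \<forall>V\<in>\<U>. \<exists>W\<in>\<U>. U \<subseteq> W \<and> V \<subseteq> W) \<longrightarrow>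
          emeasure M (\<Union>\<U>) = (SUP U\<in>\<U>. emeasure M U))"

text \<open>
  A finitely supported measure is a finite combination of point masses. It is not required to have
  total mass one: if the weak limit is a probability measure, the total masses converge to one, so
  normalising changes nothing. Being carried by a finite set is demanded rather than finiteness of
  \<open>msupport\<close>, which on a non-separable space need not by itself carry the measure.
\<close>

definition finitely_supported :: "'a::topological_space measure \<Rightarrow> bool" where
  "finitely_supported M \<longleftrightarrow>
    sets M = sets borel \<and> finite_measure M \<and> (\<exists>F. finite F \<and> emeasure M (UNIV - F) = 0)"

definition weak_limit ::
    "(nat \<Rightarrow> 'a::topological_space measure) \<Rightarrow> 'a measure \<Rightarrow> bool" where
  "weak_limit Ms M \<longleftrightarrow>
    (\<forall>f :: 'a \<Rightarrow> real. continuous_on UNIV f \<and> bounded (range f) \<longrightarrow>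
       (\<lambda>n. integral\<^sup>L (Ms n) f) \<longlonglongrightarrow> integral\<^sup>L M f)"

definition inner_regular :: "'a::topological_space measure \<Rightarrow> bool" where
  "inner_regular M \<longleftrightarrow>
    (\<forall>A\<in>sets borel. \<forall>\<epsilon>>0. \<exists>K. compact K \<and> K \<subseteq> A \<and> measure M A - \<epsilon> < measure M K)"

definition regular_prob_measures :: "'a::metric_space measure set" where
  "regular_prob_measures =
    {M. sets M = sets borel \<and> prob_space M \<and>
        emeasure M (msupport M) = 1 \<and>
        tau_additive M \<and>
        (\<exists>Ms. (\<forall>n. finitely_supported (Ms n)) \<and> weak_limit Ms M) \<and>
        inner_regular M}"

definition stochastic_le :: "'a::{topological_space, order} measure \<Rightarrow> 'a measure \<Rightarrow> bool" where
  "stochastic_le M N \<longleftrightarrow> (\<forall>U. open U \<and> upper_set U \<longrightarrow> emeasure M U \<le> emeasure N U)"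

end

theory Submission
  imports Defs
begin

text \<open>
  By the layer cake formula the integral of a non-negative \<open>f\<close> is
  \<open>\<integral> \<mu>{f > t} dt\<close>, and \<open>{f > t}\<close> is an open upper set when \<open>f\<close> is
  continuous and monotone. Conversely, let \<open>U\<close> be an open upper set and \<open>K \<subseteq> U\<close> compact
  with almost the same \<open>\<mu>\<close>-measure. The upper closure of \<open>K\<close> is a closed upper set inside
  \<open>U\<close>, and Nachbin's order version of Urysohn's lemma gives a continuous monotone
  \<open>f : X \<rightarrow> [0,1]\<close> equal to one on it and to zero off \<open>U\<close>; then
  \<open>\<mu>(K) \<le> \<integral> f d\<mu> \<le> \<integral> f d\<nu> \<le> \<nu>(U)\<close>.
\<close>

section \<open>Preliminaries on upper sets, monotonicity, continuity and dyadic fractions\<close>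

lemma upper_set_Compl: "upper_set (- A) \<longleftrightarrow> lower_set A"
  unfolding upper_set_def lower_set_def by blast

lemma lower_set_Compl: "lower_set (- A) \<longleftrightarrow> upper_set A"
  unfolding upper_set_def lower_set_def by blast

lemma mono_if_upper_set_superlevels:
  fixes f :: "'a::order \<Rightarrow> real"
  assumes "\<And>t. upper_set {x. t < f x}"
  shows "mono f"
proof (rule monoI, rule ccontr)
  fix x y :: 'a assume "x \<le> y" "\<not> f x \<le> f y"
  then show False
    using assms[of "f y"] unfolding upper_set_def by (auto simp: not_le)
qed

lemma continuous_on_if_open_rays:
  fixes f :: "'a::topological_space \<Rightarrow> real"
  assumes "\<And>t. open {x. t < f x}" and "\<And>t. open {x. f x < t}"
  shows "continuous_on UNIV f"
  unfolding continuous_on_def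
proof (intro ballI order_tendstoI)
  fix x a assume "a < f x"
  then show "\<forall>\<^sub>F y in at x within UNIV. a < f y"
    using assms(1)[of a] unfolding eventually_at_topological by (intro exI[of _ "{x. a < f x}"]) auto
next
  fix x a assume "f x < a"
  then show "\<forall>\<^sub>F y in at x within UNIV. f y < a"
    using assms(2)[of a] unfolding eventually_at_topological by (intro exI[of _ "{x. f x < a}"]) auto
qed

text \<open>Two fractions straddling the midpoint at distance below half the length leave the larger
  one in the interval. The bound \<open>0 \<le> a\<close> is there because \<open>dyadics\<close>
  contains only non-negative fractions.\<close>

lemma dyadic_between:
  fixes a b :: real
  assumes "0 \<le> a" "a < b"
  obtains r where "r \<in> dyadics" "a < r" "r < b"
proof -
  have "(b - a) / 2 > 0" "(1::real) < 2" "(a + b) / 2 > 0"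
    using assms by auto
  then obtain n q r where "of_nat q / 2 ^ n < (a + b) / 2" "(a + b) / 2 < of_nat r / 2 ^ n"
      "\<bar>real q / 2 ^ n - real r / 2 ^ n\<bar> < (b - a) / 2"
    by (rule padic_rational_approximation_straddle_pos)
  then have "a < real r / 2 ^ n" "real r / 2 ^ n < b"
    using assms by (auto simp: field_simps abs_less_iff)
  moreover have "real r / 2 ^ n \<in> dyadics"
    unfolding dyadics_def by auto
  ultimately show thesis
    by (rule that[rotated])
qed

section \<open>Separation and closedness in the ordered space\<close>

lemma upper_set_interpolation:
  fixes C T :: "'a::{topological_space, order} set"
  assumes "monotone_normal TYPE('a)"
    and "closed C" "upper_set C" "open T" "upper_set T" "C \<subseteq> T"
  obtains U D where "open U" "upper_set U" "closed D" "upper_set D" "C \<subseteq> U" "U \<subseteq> D" "D \<subseteq> T"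
proof -
  \<comment> \<open>Monotone normality applies to \<open>C\<close> and the closed lower set
    \<open>- T\<close>; the complement of the open lower set around \<open>- T\<close> is the
    required \<open>D\<close>.\<close>
  have "closed C \<and> upper_set C \<and> closed (- T) \<and> lower_set (- T) \<and> C \<inter> - T = {}"
    using assms lower_set_Compl by auto
  then obtain U V where UV: "open U" "upper_set U" "C \<subseteq> U" "open V" "lower_set V" "- T \<subseteq> V"
      "U \<inter> V = {}"
    using assms(1) unfolding monotone_normal_def by metis
  show thesis
    by (rule that[of U "- V"]) (use UV upper_set_Compl in auto)
qed

text \<open>Urysohn's construction survives the order because every inserted set can be chosen
  upper: \<open>f x\<close> is the largest index, as a supremum, of a decreasing dyadic family of
  open upper sets containing \<open>x\<close>.\<close>

lemma monotone_Urysohn: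
  fixes A T :: "'a::{topological_space, order} set"
  assumes normal: "monotone_normal TYPE('a)"
    and A: "closed A" "upper_set A" and T: "open T" "upper_set T" and "A \<subseteq> T"
  obtains f :: "'a \<Rightarrow> real"
    where "continuous_on UNIV f" "mono f" "\<And>x. 0 \<le> f x" "\<And>x. f x \<le> 1"
      "\<And>x. x \<in> A \<Longrightarrow> f x = 1" "\<And>x. x \<notin> T \<Longrightarrow> f x = 0"
proof -
  \<comment> \<open>The intermediate closed set must itself be upper, so that interpolation can be
    repeated on either side of it.\<close>
  define R where "R P Q \<longleftrightarrow> open P \<and> upper_set P \<and> open Q \<and> upper_set Q \<and>
    (\<exists>C. closed C \<and> upper_set C \<and> Q \<subseteq> C \<and> C \<subseteq> P)" for P Q :: "'a set"
  obtain U D where "open U" "upper_set U" "closed D" "upper_set D" "A \<subseteq> U" "U \<subseteq> D" "D \<subseteq> T"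
    using upper_set_interpolation[OF normal A T \<open>A \<subseteq> T\<close>] .
  then have "R T U"
    using T unfolding R_def by blast
  have "\<exists>G :: real \<Rightarrow> 'a set. G 0 = T \<and> G 1 = U \<and>
     (\<forall>r \<in> dyadics \<inter> {0..1}. \<forall>s \<in> dyadics \<inter> {0..1}. r < s \<longrightarrow> R (G r) (G s))"
  proof (rule recursion_on_dyadic_fractions)
    show "R T U" by fact
  next
    fix P Q assume "R P Q"
    then obtain C where PQ: "open P" "upper_set P" "open Q" "upper_set Q"
      and C: "closed C" "upper_set C" "Q \<subseteq> C" "C \<subseteq> P"
      unfolding R_def by blast
    \<comment> \<open>Interpolating between \<open>C\<close> and \<open>P\<close>, not between
      \<open>Q\<close> and \<open>P\<close>, makes \<open>E\<close> a witness for
      \<open>R P V\<close> and \<open>C\<close> a witness for \<open>R V Q\<close>.\<close>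
    obtain V E where "open V" "upper_set V" "closed E" "upper_set E" "C \<subseteq> V" "V \<subseteq> E" "E \<subseteq> P"
      using upper_set_interpolation[OF normal C(1,2) PQ(1,2) C(4)] .
    then have "R P V" "R V Q"
      using PQ C unfolding R_def by blast+
    then show "\<exists>V. R P V \<and> R V Q" by blast
  next
    fix P Q S assume "R P Q" "R Q S"
    then show "R P S"
      unfolding R_def by blast
  qed
  then obtain G :: "real \<Rightarrow> 'a set" where G01: "G 0 = T" "G 1 = U"
    and G: "\<And>r s. r \<in> dyadics \<inter> {0..1} \<Longrightarrow> s \<in> dyadics \<inter> {0..1} \<Longrightarrow> r < s \<Longrightarrow> R (G r) (G s)"
    by blast
  have D01: "0 \<in> dyadics \<inter> {0..1::real}" "1 \<in> dyadics \<inter> {0..1::real}"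
    by (force simp: dyadics_def)+
  have G_upper: "open (G r) \<and> upper_set (G r)" if "r \<in> dyadics \<inter> {0..1}" for r
  proof (cases "r = 0")
    case True
    then show ?thesis using G01 T by simp
  next
    case False
    then show ?thesis
      using G[OF D01(1) that] that unfolding R_def by auto
  qed
  have G_antimono: "G s \<subseteq> G r"
    if "r \<in> dyadics \<inter> {0..1}" "s \<in> dyadics \<inter> {0..1}" "r < s" for r s
    using G[OF that] unfolding R_def by blast
  \<comment> \<open>Inserting 0 keeps the set nonempty at points lying in no \<open>G r\<close>,
    where \<open>f\<close> is to vanish.\<close>
  define f where "f x = Sup (insert 0 {r \<in> dyadics \<inter> {0..1}. x \<in> G r})" for x
  have bdd: "bdd_above (insert 0 {r \<in> dyadics \<inter> {0..1::real}. x \<in> G r})" for x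
    by (rule bdd_aboveI[of _ 1]) auto
  have f_le: "f x \<le> c" if "0 \<le> c" "\<And>r. r \<in> dyadics \<inter> {0..1} \<Longrightarrow> x \<in> G r \<Longrightarrow> r \<le> c" for x c
    unfolding f_def by (rule cSup_least) (use that in auto)
  have f_ge: "r \<le> f x" if "r \<in> dyadics \<inter> {0..1}" "x \<in> G r" for x r
    unfolding f_def by (rule cSup_upper[OF _ bdd]) (use that in auto)
  have f_nonneg: "0 \<le> f x" for x
    unfolding f_def by (rule cSup_upper[OF _ bdd]) auto
  have f_le_1: "f x \<le> 1" for x
    by (rule f_le) auto
  \<comment> \<open>Superlevel sets are unions of open upper sets, which yields lower semicontinuity
    and monotonicity together.\<close>
  have superlevel: "{x. t < f x} = (\<Union>r \<in> {r \<in> dyadics \<inter> {0..1}. t < r}. G r)" if "0 \<le> t" for t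
  proof (intro equalityI subsetI)
    fix x assume "x \<in> {x. t < f x}"
    then have "\<not> f x \<le> t" by simp
    then obtain r where "r \<in> dyadics \<inter> {0..1}" "x \<in> G r" "\<not> r \<le> t"
      using f_le[OF \<open>0 \<le> t\<close>] by blast
    then show "x \<in> (\<Union>r \<in> {r \<in> dyadics \<inter> {0..1}. t < r}. G r)"
      by auto
  next
    fix x assume "x \<in> (\<Union>r \<in> {r \<in> dyadics \<inter> {0..1}. t < r}. G r)"
    then obtain r where "r \<in> dyadics \<inter> {0..1}" "t < r" "x \<in> G r"
      by auto
    then show "x \<in> {x. t < f x}"
      using f_ge by fastforce
  qed
  have superlevel_neg: "{x. t < f x} = UNIV" if "t < 0" for t
    using less_le_trans[OF that f_nonneg] by auto
  have open_upper: "open {x. t < f x} \<and> upper_set {x. t < f x}" for t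
  proof (cases "0 \<le> t")
    case True
    have "upper_set (\<Union>r \<in> {r \<in> dyadics \<inter> {0..1}. t < r}. G r)"
      using G_upper unfolding upper_set_def by blast
    then show ?thesis
      unfolding superlevel[OF True] using G_upper by auto
  next
    case False
    then show ?thesis
      using superlevel_neg by (simp add: upper_set_def)
  qed
  \<comment> \<open>Upper semicontinuity uses the closed sets between the \<open>G r\<close>. For
    dyadic \<open>f x < r < s < t\<close> take closed \<open>C\<close> with
    \<open>G s \<subseteq> C \<subseteq> G r\<close>. Then \<open>x\<close> is outside
    \<open>C\<close>, and a point outside \<open>C\<close> lies in no \<open>G q\<close> with
    \<open>q \<ge> s\<close>, so \<open>f\<close> is at most \<open>s\<close> there. The case
    \<open>t > 1\<close> is split off because \<open>r\<close> and \<open>s\<close> must be indices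
    in \<open>{0..1}\<close>.\<close>
  have open_sublevel: "open {x. f x < t}" for t
  proof (subst open_subopen, intro ballI)
    fix x assume "x \<in> {x. f x < t}"
    then have "f x < t" by simp
    show "\<exists>V. open V \<and> x \<in> V \<and> V \<subseteq> {x. f x < t}"
    proof (cases "t > 1")
      case True
      then show ?thesis
        using le_less_trans[OF f_le_1 True] by (intro exI[of _ UNIV]) auto
    next
      case False
      obtain r where r: "r \<in> dyadics" "f x < r" "r < t"
        using dyadic_between[OF f_nonneg \<open>f x < t\<close>] .
      moreover have "0 \<le> r"
        using r f_nonneg[of x] by linarith
      ultimately obtain s where s: "s \<in> dyadics" "r < s" "s < t"
        using dyadic_between by blast
      have rs: "r \<in> dyadics \<inter> {0..1}" "s \<in> dyadics \<inter> {0..1}"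
        using r s False \<open>0 \<le> r\<close> by auto
      obtain C where C: "closed C" "G s \<subseteq> C" "C \<subseteq> G r"
        using G[OF rs s(2)] unfolding R_def by blast
      have "x \<notin> C"
        using C(3) f_ge[OF rs(1), of x] r(2) by auto
      moreover have "f y < t" if "y \<notin> C" for y
      proof -
        have "f y \<le> s"
        proof (rule f_le)
          fix q assume "q \<in> dyadics \<inter> {0..1}" "y \<in> G q"
          then show "q \<le> s"
            using G_antimono[OF rs(2), of q] C(2) that by (meson linorder_not_le subsetD)
        qed (use rs in auto)
        then show ?thesis using s(3) by simp
      qed
      ultimately show ?thesis
        using C(1) by (intro exI[of _ "- C"]) auto
    qed
  qed
  show thesis
  proof (rule that[of f])
    show "continuous_on UNIV f"
      by (rule continuous_on_if_open_rays) (use open_upper open_sublevel in auto)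
    show "mono f"
      by (rule mono_if_upper_set_superlevels) (use open_upper in auto)
    show "f x = 1" if "x \<in> A" for x
      using f_ge[OF D01(2), of x] f_le_1[of x] G01 \<open>A \<subseteq> U\<close> that by auto
    show "f x = 0" if "x \<notin> T" for x
    proof -
      have "r \<le> 0" if "r \<in> dyadics \<inter> {0..1}" "x \<in> G r" for r
        using G_antimono[OF D01(1) that(1)] G01 \<open>x \<notin> T\<close> that(2) by (cases "r = 0") (use that(1) in auto)
      then have "f x \<le> 0"
        by (intro f_le) auto
      then show ?thesis
        using f_nonneg[of x] by simp
    qed
  qed (use f_nonneg f_le_1 in auto)
qed

text \<open>The set is the projection of the part of the order relation lying over \<open>K\<close>,
  and projecting along a compact factor is a closed map.\<close>

lemma closed_upper_closure_compact:
  fixes K :: "'a::{topological_space, order} set"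
  assumes "closed_order TYPE('a)" "compact K"
  shows "closed {y. \<exists>x\<in>K. x \<le> y}"
proof -
  have "closedin (top_of_set (K \<times> UNIV)) ((K \<times> UNIV) \<inter> {(x :: 'a, y). x \<le> y})"
    using assms(1) unfolding closed_order_def by (rule closedin_closed_Int)
  moreover have "closed_map (top_of_set (K \<times> UNIV)) euclidean (snd :: 'a \<times> 'a \<Rightarrow> 'a)"
    using Abstract_Topological_Spaces.closed_map_snd[of "top_of_set K" "euclidean :: 'a topology"]
      prod_topology_subtopology_eu[of K "UNIV :: 'a set"] assms(2)
    by (simp add: compact_space_subtopology)
  ultimately have "closed (snd ` ((K \<times> UNIV) \<inter> {(x :: 'a, y). x \<le> y}))"
    unfolding closed_map_def by simp
  also have "snd ` ((K \<times> UNIV) \<inter> {(x :: 'a, y). x \<le> y}) = {y. \<exists>x\<in>K. x \<le> y}"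
    by force
  finally show ?thesis .
qed

section \<open>Passing between integrals and the stochastic order\<close>

lemma nn_integral_layer_cake:
  fixes f :: "'a \<Rightarrow> real"
  assumes "sigma_finite_measure M" and [measurable]: "f \<in> borel_measurable M"
    and "\<And>x. x \<in> space M \<Longrightarrow> 0 \<le> f x"
  shows "(\<integral>\<^sup>+ x. ennreal (f x) \<partial>M) =
    (\<integral>\<^sup>+ t. indicator {0..} t * emeasure M {x \<in> space M. t < f x} \<partial>lborel)"
proof -
  interpret sigma_finite_measure M by fact
  interpret pair_sigma_finite lborel M ..
  have "(\<integral>\<^sup>+ x. ennreal (f x) \<partial>M) =
      (\<integral>\<^sup>+ x. \<integral>\<^sup>+ t. indicator {0..} t * indicator {x \<in> space M. t < f x} x \<partial>lborel \<partial>M)"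
  proof (rule nn_integral_cong)
    fix x assume x: "x \<in> space M"
    \<comment> \<open>For fixed \<open>x\<close> the integrand is the indicator of
      \<open>{0..<f x}\<close>, an interval of length \<open>f x\<close>; Tonelli then swaps the two
      integrals.\<close>
    have "(\<integral>\<^sup>+ t. indicator {0..} t * indicator {x \<in> space M. t < f x} x \<partial>lborel) =
        (\<integral>\<^sup>+ t. indicator {0..<f x} t \<partial>lborel)"
      by (intro nn_integral_cong) (auto simp: indicator_def x)
    then show "ennreal (f x) =
        (\<integral>\<^sup>+ t. indicator {0..} t * indicator {x \<in> space M. t < f x} x \<partial>lborel)"
      using assms(3)[OF x] by simp
  qed
  also have "\<dots> =
      (\<integral>\<^sup>+ t. \<integral>\<^sup>+ x. indicator {0..} t * indicator {x \<in> space M. t < f x} x \<partial>M \<partial>lborel)"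
    by (rule Fubini') measurable
  also have "\<dots> = (\<integral>\<^sup>+ t. indicator {0..} t * emeasure M {x \<in> space M. t < f x} \<partial>lborel)"
    by (intro nn_integral_cong) (simp add: nn_integral_cmult)
  finally show ?thesis .
qed

text \<open>The layer cake integrands compare at each level \<open>t\<close>. Since \<open>f\<close>
  may be unbounded and both integrals infinite, this serves both integral conditions.\<close>

lemma stochastic_le_imp_nn_integral_le:
  fixes \<mu> \<nu> :: "'a::{topological_space, order} measure" and f :: "'a \<Rightarrow> real"
  assumes "sigma_finite_measure \<mu>" "sets \<mu> = sets borel"
    and "sigma_finite_measure \<nu>" "sets \<nu> = sets borel"
    and le: "stochastic_le \<mu> \<nu>"
    and f: "continuous_on UNIV f" "mono f" "\<And>x. 0 \<le> f x"
  shows "(\<integral>\<^sup>+ x. ennreal (f x) \<partial>\<mu>) \<le> (\<integral>\<^sup>+ x. ennreal (f x) \<partial>\<nu>)"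
proof -
  have "f \<in> borel_measurable borel"
    using f(1) by (rule borel_measurable_continuous_onI)
  then have meas: "f \<in> borel_measurable \<mu>" "f \<in> borel_measurable \<nu>"
    using assms(2,4) by (simp_all cong: measurable_cong_sets)
  have space: "space \<mu> = UNIV" "space \<nu> = UNIV"
    using assms(2,4)[THEN sets_eq_imp_space_eq] by simp_all
  have "emeasure \<mu> {x. t < f x} \<le> emeasure \<nu> {x. t < f x}" for t
  proof -
    have "open {x. t < f x}"
      using f(1) by (intro open_Collect_less continuous_on_const)
    moreover have "upper_set {x. t < f x}"
      using f(2) unfolding upper_set_def mono_def by (auto intro: less_le_trans)
    ultimately show ?thesis
      using le unfolding stochastic_le_def by blast
  qed
  then show ?thesis
    using nn_integral_layer_cake[OF assms(1) meas(1) f(3)]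
      nn_integral_layer_cake[OF assms(3) meas(2) f(3)]
    by (auto simp: space intro!: nn_integral_mono mult_left_mono)
qed

text \<open>Only bounded test functions are assumed, so either integral condition suffices. The
  Hausdorff sort makes compact sets Borel.\<close>

lemma stochastic_le_if_nn_integral_le:
  fixes \<mu> \<nu> :: "'a::{t2_space, order} measure"
  assumes order: "closed_order TYPE('a)" "monotone_normal TYPE('a)"
    and \<mu>: "finite_measure \<mu>" "sets \<mu> = sets borel" "inner_regular \<mu>"
    and \<nu>: "sets \<nu> = sets borel"
    and le: "\<And>f :: 'a \<Rightarrow> real. continuous_on UNIV f \<Longrightarrow> bounded (range f) \<Longrightarrow> mono f \<Longrightarrow>
      (\<And>x. 0 \<le> f x) \<Longrightarrow> (\<integral>\<^sup>+ x. ennreal (f x) \<partial>\<mu>) \<le> (\<integral>\<^sup>+ x. ennreal (f x) \<partial>\<nu>)"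
  shows "stochastic_le \<mu> \<nu>"
  unfolding stochastic_le_def
proof (intro allI impI, elim conjE)
  fix U :: "'a set" assume U: "open U" "upper_set U"
  interpret \<mu>: finite_measure \<mu> by (rule \<mu>(1))
  show "emeasure \<mu> U \<le> emeasure \<nu> U"
  proof (rule ennreal_le_epsilon)
    fix e :: real assume "0 < e"
    then obtain K where K: "compact K" "K \<subseteq> U" "measure \<mu> U - e < measure \<mu> K"
      using \<mu>(3) U(1) unfolding inner_regular_def by (meson borel_open)
    \<comment> \<open>Urysohn separation needs a closed upper set, which \<open>K\<close> need not
      be; passing to \<open>A\<close> stays inside \<open>U\<close> because \<open>U\<close> is
      upper.\<close>
    define A where "A = {y. \<exists>x\<in>K. x \<le> y}"
    have "closed A"
      unfolding A_def by (rule closed_upper_closure_compact[OF order(1) K(1)])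
    moreover have "upper_set A"
      unfolding A_def upper_set_def by (blast intro: order_trans)
    moreover have "A \<subseteq> U"
      unfolding A_def using K(2) U(2) upper_set_def by blast
    ultimately obtain f :: "'a \<Rightarrow> real"
      where f: "continuous_on UNIV f" "mono f" "\<And>x. 0 \<le> f x" "\<And>x. f x \<le> 1"
        "\<And>x. x \<in> A \<Longrightarrow> f x = 1" "\<And>x. x \<notin> U \<Longrightarrow> f x = 0"
      using monotone_Urysohn[OF order(2) _ _ U] by blast
    have "bounded (range f)"
      using f(3,4) by (intro boundedI[of _ 1]) auto
    have "K \<subseteq> A"
      unfolding A_def by auto
    \<comment> \<open>The chain rests on the sandwich of \<open>f\<close> between the indicators of
      \<open>K\<close> and \<open>U\<close>.\<close>
    have "emeasure \<mu> K = (\<integral>\<^sup>+ x. indicator K x \<partial>\<mu>)"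
      using \<mu>(2) K(1) by (simp add: borel_compact)
    also have "\<dots> \<le> (\<integral>\<^sup>+ x. ennreal (f x) \<partial>\<mu>)"
      using f(5) \<open>K \<subseteq> A\<close> by (intro nn_integral_mono) (auto simp: indicator_def subset_iff)
    also have "\<dots> \<le> (\<integral>\<^sup>+ x. ennreal (f x) \<partial>\<nu>)"
      by (rule le) fact+
    also have "\<dots> \<le> (\<integral>\<^sup>+ x. indicator U x \<partial>\<nu>)"
      using f(4,6) by (intro nn_integral_mono) (auto simp: indicator_def)
    also have "\<dots> = emeasure \<nu> U"
      using \<nu> U(1) by simp
    finally have "emeasure \<mu> K \<le> emeasure \<nu> U" .
    moreover have "emeasure \<mu> U \<le> emeasure \<mu> K + ennreal e"
      using K(3) \<open>0 < e\<close> by (simp add: \<mu>.emeasure_eq_measure flip: ennreal_plus)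
    ultimately show "emeasure \<mu> U \<le> emeasure \<nu> U + ennreal e"
      by (rule order_trans[OF _ add_right_mono, rotated])
  qed
qed

theorem proposition3p11:
  fixes \<mu> \<nu> :: "'a::{metric_space, order} measure"
  assumes "closed_order TYPE('a)"
    and "monotone_normal TYPE('a)"
    and "\<mu> \<in> regular_prob_measures"
    and "\<nu> \<in> regular_prob_measures"
  shows "(stochastic_le \<mu> \<nu> \<longleftrightarrow>
           (\<forall>f :: 'a \<Rightarrow> real. continuous_on UNIV f \<and> mono f \<and> (\<forall>x. 0 \<le> f x) \<longrightarrow>
              (\<integral>\<^sup>+ x. ennreal (f x) \<partial>\<mu>) \<le> (\<integral>\<^sup>+ x. ennreal (f x) \<partial>\<nu>)))
       \<and> (stochastic_le \<mu> \<nu> \<longleftrightarrow>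
           (\<forall>f :: 'a \<Rightarrow> real. continuous_on UNIV f \<and> bounded (range f) \<and> mono f \<and> (\<forall>x. 0 \<le> f x) \<longrightarrow>
              (\<integral>\<^sup>+ x. ennreal (f x) \<partial>\<mu>) \<le> (\<integral>\<^sup>+ x. ennreal (f x) \<partial>\<nu>)))"
proof -
  have \<mu>: "prob_space \<mu>" "sets \<mu> = sets borel" "inner_regular \<mu>"
    and \<nu>: "prob_space \<nu>" "sets \<nu> = sets borel"
    using assms(3,4) unfolding regular_prob_measures_def by auto
  interpret \<mu>: prob_space \<mu> by fact
  interpret \<nu>: prob_space \<nu> by fact
  note forward = stochastic_le_imp_nn_integral_le[OF \<mu>.sigma_finite_measure_axioms \<mu>(2)
      \<nu>.sigma_finite_measure_axioms \<nu>(2)]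
  note backward = stochastic_le_if_nn_integral_le[OF assms(1,2) \<mu>.finite_measure_axioms
      \<mu>(2,3) \<nu>(2)]
  show ?thesis
    by (intro conjI iffI allI impI; rule forward backward; blast)
qed

end
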